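(* Let $E$ be a finite ground set and let $X \subseteq \{0,1\}^E$ be non-empty. If $S \subseteq E$ is identifying for $X$, then $S$ is controlling for $(X,\mathcal{C})$, where $\mathcal{C}$ is the class of all functions $c\colon X \to \mathbb{R}$.
   Context: A set $S \subseteq E$ is controlling for $(X,\mathcal{C})$ if for every $c \in \mathcal{C}$ and every $x^* \in X$ there is $\gamma \in \mathbb{R}^S$ such that the minimum $\min_{x \in X}\{c(x) + \sum_{e\in S}\gamma_e x_e\}$ exists and is attained at $x^*$. A set $S \subseteq E$ is identifying for $X$ if for all $x, x' \in X$ with $x \neq x'$ there is $e \in S$ with $x_e \neq x'_e$. *)

theory Defs
  imports Complex_Main "HOL-Library.FuncSet"
begin

text \<open>
  Vectors indexed by a set \<open>A\<close> and functions with domain \<open>A\<close> are elements of the extensional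
  function space \<open>A \<rightarrow>\<^sub>E B\<close>, so that equality of vectors is equality of their entries on \<open>A\<close>.
  In both definitions \<open>S\<close> is understood to be a subset of the ground set indexing the vectors.
\<close>

definition identifying :: "('e \<Rightarrow> real) set \<Rightarrow> 'e set \<Rightarrow> bool" where
  "identifying X S \<longleftrightarrow> (\<forall>x\<in>X. \<forall>x'\<in>X. x \<noteq> x' \<longrightarrow> (\<exists>e\<in>S. x e \<noteq> x' e))"

definition controlling ::
    "('e \<Rightarrow> real) set \<Rightarrow> (('e \<Rightarrow> real) \<Rightarrow> real) set \<Rightarrow> 'e set \<Rightarrow> bool" where
  "controlling X \<C> S \<longleftrightarrow>
     (\<forall>c\<in>\<C>. \<forall>xs\<in>X. \<exists>\<gamma>\<in>S \<rightarrow>\<^sub>E UNIV.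
        is_arg_min (\<lambda>x. c x + (\<Sum>e\<in>S. \<gamma> e * x e)) (\<lambda>x. x \<in> X) xs)"

end

theory Submission
  imports Defs
begin

text \<open>
  Given a target \<open>x\<^sup>*\<close>, put \<open>\<gamma>\<^sub>e = M (1 - 2 x\<^sup>*\<^sub>e)\<close> on \<open>S\<close>. On 0/1 vectors, moving from \<open>x\<^sup>*\<close> to \<open>x\<close>
  raises the linear term by \<open>M\<close> times the Hamming distance of their restrictions to \<open>S\<close>. As \<open>S\<close> is
  identifying, this is at least \<open>M\<close> for \<open>x \<noteq> x\<^sup>*\<close>, so it suffices that \<open>M\<close> bounds the largest possible
  gain \<open>c(x\<^sup>*) - c(x)\<close>, which is finite because \<open>X\<close> is.
\<close>

text \<open>With 0/1 entries, a coordinate adds \<open>M\<close> to the difference of the two sums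
  if \<open>x\<close> and \<open>y\<close> disagree there, and 0 otherwise. As
  \<open>0 \<le> M\<close>, the coordinate \<open>d\<close> alone gives the bound.\<close>

lemma hamming_penalty_ge:
  fixes x y :: "'e \<Rightarrow> real"
  assumes "finite S" and "x \<in> S \<rightarrow> {0, 1}" and "y \<in> S \<rightarrow> {0, 1}"
    and "d \<in> S" and "x d \<noteq> y d" and "0 \<le> M"
  shows "(\<Sum>e\<in>S. M * (1 - 2 * x e) * x e) + M \<le> (\<Sum>e\<in>S. M * (1 - 2 * x e) * y e)"
proof -
  have diff: "M * (1 - 2 * x e) * y e - M * (1 - 2 * x e) * x e = (if x e = y e then 0 else M)"
    if "e \<in> S" for e
    using Pi_mem[OF assms(2) that] Pi_mem[OF assms(3) that] by auto
  have "M = (if x d = y d then 0 else M)"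
    using assms(5) by simp
  also have "\<dots> \<le> (\<Sum>e\<in>S. if x e = y e then 0 else M)"
    by (rule member_le_sum[OF \<open>d \<in> S\<close>]) (use assms in auto)
  also have "\<dots> = (\<Sum>e\<in>S. M * (1 - 2 * x e) * y e) - (\<Sum>e\<in>S. M * (1 - 2 * x e) * x e)"
    by (simp add: diff flip: sum_subtractf)
  finally show ?thesis
    by simp
qed

theorem theorem3p5:
  fixes E S :: "'e set" and X :: "('e \<Rightarrow> real) set"
  assumes "finite E"
    and "X \<subseteq> E \<rightarrow>\<^sub>E {0, 1}"
    and "X \<noteq> {}"
    and "S \<subseteq> E"
    and "identifying X S"
  shows "controlling X (X \<rightarrow>\<^sub>E UNIV) S"
  unfolding controlling_def
proof (intro ballI)
  fix c :: "('e \<Rightarrow> real) \<Rightarrow> real" and xs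
  assume xs: "xs \<in> X"
  have "finite S"
    using assms(1,4) finite_subset by blast
  have "finite X"
    by (rule finite_subset[OF assms(2)]) (simp add: finite_PiE assms(1))
  define M where "M = Max ((\<lambda>x. c xs - c x) ` X)"
  have M: "c xs - c x \<le> M" if "x \<in> X" for x
    unfolding M_def using \<open>finite X\<close> that by (intro Max_ge) auto
  \<comment> \<open>The target \<open>xs\<close> lies in \<open>X\<close>, so 0 is among the gains
    maximised.\<close>
  have "0 \<le> M"
    using M[OF xs] by simp
  have binary: "x \<in> S \<rightarrow> {0, 1}" if "x \<in> X" for x
    using that assms(2,4) by (auto simp: PiE_def Pi_def)
  \<comment> \<open>Restricted to \<open>S\<close> because the weights must be extensional, as
    members of \<open>S \<rightarrow>\<^sub>E UNIV\<close>.\<close>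
  define \<gamma> where "\<gamma> = (\<lambda>e\<in>S. M * (1 - 2 * xs e))"
  have \<gamma>_sum: "(\<Sum>e\<in>S. \<gamma> e * x e) = (\<Sum>e\<in>S. M * (1 - 2 * xs e) * x e)" for x
    by (rule sum.cong) (simp_all add: \<gamma>_def)
  have "c xs + (\<Sum>e\<in>S. \<gamma> e * xs e) \<le> c x + (\<Sum>e\<in>S. \<gamma> e * x e)" if x: "x \<in> X" for x
  proof (cases "x = xs")
    case False
    then obtain d where "d \<in> S" "xs d \<noteq> x d"
      using assms(5) x xs unfolding identifying_def by metis
    then show ?thesis
      using hamming_penalty_ge[OF \<open>finite S\<close> binary[OF xs] binary[OF x] _ _ \<open>0 \<le> M\<close>] M[OF x]
      by (fastforce simp: \<gamma>_sum)
  qed simp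
  then have "is_arg_min (\<lambda>x. c x + (\<Sum>e\<in>S. \<gamma> e * x e)) (\<lambda>x. x \<in> X) xs"
    using xs by (auto simp: is_arg_min_linorder)
  moreover have "\<gamma> \<in> S \<rightarrow>\<^sub>E UNIV"
    by (simp add: \<gamma>_def)
  ultimately show "\<exists>\<gamma>\<in>S \<rightarrow>\<^sub>E UNIV. is_arg_min (\<lambda>x. c x + (\<Sum>e\<in>S. \<gamma> e * x e)) (\<lambda>x. x \<in> X) xs"
    by blast
qed

end
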